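(* Let $\alpha=(\alpha_1,\dots,\alpha_s)\in\mathbb{Z}^s$ with $\alpha_i\cdot\alpha_{i+1}<0$ for all $1\le i\le s-1$ and $\alpha_1\ge 0$, and let $T$ be a tournament of order $n=\sum_{i=1}^s|\alpha_i|+1$. Then $$f_T(\alpha)=f_T(-\alpha),$$ where $-\alpha=(-\alpha_1,\dots,-\alpha_s)$ and $f_T(\gamma)$ denotes the number of oriented (here necessarily Hamiltonian) paths of $T$ of type $P(\gamma)$.
   Context: A tournament is an orientation of a finite complete graph. An oriented path $P=v_1v_2\dots v_r$ in a tournament $T$ consists of distinct vertices $v_1,\dots,v_r$ together with the arcs of $T$ joining consecutive vertices; $v_1\dots v_r$ and $v_r\dots v_1$ denote the same path, and two paths are equal iff they have the same set of arcs (a one-vertex path being determined by its vertex). A block is a maximal directed subpath. For a tuple $\alpha=(\alpha_1,\dots,\alpha_s)$ of nonzero integers with alternating signs, $v_1\dots v_r$ has type $P(\alpha)$ with respect to this enumeration if $r=\sum|\alpha_i|+1$ and, traversing from $v_1$ to $v_r$, one meets successively exactly $s$ blocks $I_1,\dots,I_s$, with $I_i$ of length $|\alpha_i|$, and $I_i$ directed in the sense of the traversal iff $\alpha_i>0$. A one-vertex path has type $P(0)$. A path is of type $P(\alpha)$ if it has this type with respect to one of its two enumerations (so a path of type $P(\alpha_1,\dots,\alpha_s)$ is also of type $P(-\alpha_s,\dots,-\alpha_1)$). $f_T(\alpha)$ is the number of paths in $T$ of type $P(\alpha)$, each path counted once. *)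

theory Defs
  imports "Graph_Theory.Pair_Digraph"
begin

locale tournament = pair_digraph T for T :: "'a pair_pre_digraph" +
  assumes exactly_one_arc:
    "\<And>u v. u \<in> pverts T \<Longrightarrow> v \<in> pverts T \<Longrightarrow> u \<noteq> v \<Longrightarrow>
      ((u, v) \<in> parcs T) \<noteq> ((v, u) \<in> parcs T)"

definition path_enum :: "'a pair_pre_digraph \<Rightarrow> 'a list \<Rightarrow> bool" where
  "path_enum T vs \<longleftrightarrow> vs \<noteq> [] \<and> distinct vs \<and> set vs \<subseteq> pverts T"

text \<open>
  A path is the subdigraph consisting of the enumerated vertices and the arcs joining
  consecutive ones, so an enumeration and its reverse yield the same path. A path with
  at least one arc is determined by its arcs; the vertex set is only needed to tell
  one-vertex paths apart.
\<close>
definition path_of :: "'a pair_pre_digraph \<Rightarrow> 'a list \<Rightarrow> 'a pair_pre_digraph" where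
  "path_of T vs =
    \<lparr> pverts = set vs,
      parcs = {(u, v) \<in> parcs T. \<exists>k. Suc k < length vs \<and> {u, v} = {vs ! k, vs ! Suc k}} \<rparr>"

definition forward_seg :: "'a pair_pre_digraph \<Rightarrow> 'a list \<Rightarrow> nat \<Rightarrow> nat \<Rightarrow> bool" where
  "forward_seg T vs i j \<longleftrightarrow> i < j \<and> j < length vs \<and> (\<forall>k\<in>{i..<j}. (vs ! k, vs ! Suc k) \<in> parcs T)"

definition backward_seg :: "'a pair_pre_digraph \<Rightarrow> 'a list \<Rightarrow> nat \<Rightarrow> nat \<Rightarrow> bool" where
  "backward_seg T vs i j \<longleftrightarrow> i < j \<and> j < length vs \<and> (\<forall>k\<in>{i..<j}. (vs ! Suc k, vs ! k) \<in> parcs T)"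

definition directed_seg :: "'a pair_pre_digraph \<Rightarrow> 'a list \<Rightarrow> nat \<Rightarrow> nat \<Rightarrow> bool" where
  "directed_seg T vs i j \<longleftrightarrow> forward_seg T vs i j \<or> backward_seg T vs i j"

text \<open>
  The pair \<open>(i, j)\<close> stands for the subpath from \<open>vs ! i\<close> to \<open>vs ! j\<close>, which has
  length \<open>j - i\<close>. Blocks have positive length, so a one-vertex path has none.
\<close>
definition blocks :: "'a pair_pre_digraph \<Rightarrow> 'a list \<Rightarrow> (nat \<times> nat) set" where
  "blocks T vs = {(i, j). directed_seg T vs i j \<and>
    (\<forall>i' j'. i' \<le> i \<longrightarrow> j \<le> j' \<longrightarrow> directed_seg T vs i' j' \<longrightarrow> i' = i \<and> j' = j)}"

text \<open>
  The list \<open>bs\<close> enumerates all blocks in the order in which they are met.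
  The type \<open>[0]\<close> of one-vertex paths is a separate convention.
\<close>
definition has_type :: "'a pair_pre_digraph \<Rightarrow> 'a list \<Rightarrow> int list \<Rightarrow> bool" where
  "has_type T vs \<alpha> \<longleftrightarrow>
    (if \<alpha> = [0] then length vs = 1
     else int (length vs) = (\<Sum>a\<leftarrow>\<alpha>. \<bar>a\<bar>) + 1 \<and>
       (\<exists>bs. set bs = blocks T vs \<and> sorted_wrt (\<lambda>b b'. fst b < fst b') bs \<and>
         length bs = length \<alpha> \<and>
         (\<forall>m < length \<alpha>. case bs ! m of (i, j) \<Rightarrow>
            int (j - i) = \<bar>\<alpha> ! m\<bar> \<and> (forward_seg T vs i j \<longleftrightarrow> \<alpha> ! m > 0))))"

definition paths_of_type :: "'a pair_pre_digraph \<Rightarrow> int list \<Rightarrow> 'a pair_pre_digraph set" where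
  "paths_of_type T \<alpha> = {P. \<exists>vs. path_enum T vs \<and> P = path_of T vs \<and> has_type T vs \<alpha>}"

definition num_paths :: "'a pair_pre_digraph \<Rightarrow> int list \<Rightarrow> nat" where
  "num_paths T \<alpha> = card (paths_of_type T \<alpha>)"

end

(*
  Encode an enumeration of the vertices by its step word, which records for each pair of
  consecutive vertices whether the arc goes forward. For any relation on a finite set, a word w
  and its reversal have equally many enumerations: by inclusion-exclusion one may replace
  "backward" constraints by "forward" and "no" constraints, and an enumeration without backward
  constraints is a concatenation of directed paths, whose order may be reversed. In a
  tournament, reversing an enumeration turns w into the complement of its reversal, so w and
  its complement have equally many enumerations. Finally, a path with an arc has exactly two
  enumerations, both of which have word w precisely when w is the complement of its own
  reversal, a condition invariant under complementation.
*)
theory Submission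
  imports Defs
begin

section \<open>Step words\<close>

fun steps :: "('a \<times> 'a) set \<Rightarrow> 'a list \<Rightarrow> bool list" where
  "steps R (x # y # zs) = ((x, y) \<in> R) # steps R (y # zs)"
| "steps R _ = []"

lemma length_steps [simp]: "length (steps R vs) = length vs - 1"
  by (induction R vs rule: steps.induct) auto

lemma nth_steps: "Suc k < length vs \<Longrightarrow> steps R vs ! k \<longleftrightarrow> (vs ! k, vs ! Suc k) \<in> R"
proof (induction R vs arbitrary: k rule: steps.induct)
  case (1 R x y zs)
  then show ?case by (cases k) auto
qed auto

lemma steps_append:
  assumes "xs \<noteq> []" "ys \<noteq> []"
  shows "steps R (xs @ ys) = steps R xs @ ((last xs, hd ys) \<in> R) # steps R ys"
  using assms
proof (induction R xs rule: steps.induct)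
  case ("2_2" R x)
  then show ?case by (cases ys) auto
qed auto

text \<open>Reversal swaps every consecutive pair besides reversing their order. For distinct
  elements exactly one orientation lies in \<open>R\<close>, so each swap negates the recorded
  bit.\<close>

lemma steps_rev:
  assumes "distinct vs"
    and "\<And>u v. u \<in> set vs \<Longrightarrow> v \<in> set vs \<Longrightarrow> u \<noteq> v \<Longrightarrow> ((u, v) \<in> R) \<noteq> ((v, u) \<in> R)"
  shows "steps R (rev vs) = map Not (rev (steps R vs))"
  using assms
proof (induction R vs rule: steps.induct)
  case (1 R x y zs)
  have "steps R (rev (x # y # zs)) = steps R (rev (y # zs) @ [x])" by simp
  also have "\<dots> = steps R (rev (y # zs)) @ [(y, x) \<in> R]"
    by (subst steps_append) (simp_all add: last_rev)
  also have "steps R (rev (y # zs)) = map Not (rev (steps R (y # zs)))"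
    using 1 by (metis distinct.simps(2) list.set_intros(2))
  also have "((y, x) \<in> R) = ((x, y) \<notin> R)"
    using "1.prems" by (metis distinct_length_2_or_more list.set_intros)
  finally show ?case by simp
qed auto

section \<open>Counting enumerations with a prescribed step word\<close>

text \<open>The entry \<open>None\<close> of a pattern leaves the corresponding step unconstrained.\<close>
definition pattern_enums :: "('a \<times> 'a) set \<Rightarrow> 'a set \<Rightarrow> bool option list \<Rightarrow> 'a list set" where
  "pattern_enums R V p = {vs. vs \<noteq> [] \<and> distinct vs \<and> set vs = V \<and>
     list_all2 (\<lambda>c b. c = None \<or> c = Some b) p (steps R vs)}"

definition word_enums :: "('a \<times> 'a) set \<Rightarrow> 'a set \<Rightarrow> bool list \<Rightarrow> 'a list set" where
  "word_enums R V w = {vs. vs \<noteq> [] \<and> distinct vs \<and> set vs = V \<and> steps R vs = w}"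

lemma finite_pattern_enums:
  assumes "finite V"
  shows "finite (pattern_enums R V p)"
  by (rule finite_subset[OF _ finite_subset_distinct[OF assms]]) (auto simp: pattern_enums_def)

lemma pattern_enums_None:
  "pattern_enums R V (p @ None # q) =
     pattern_enums R V (p @ Some True # q) \<union> pattern_enums R V (p @ Some False # q)"
proof -
  let ?Q = "\<lambda>c b. c = None \<or> c = Some (b :: bool)"
  \<comment> \<open>Isolating the middle entry \<open>c\<close> makes the three patterns differ only
    in \<open>?Q c b\<close>.\<close>
  have split: "list_all2 ?Q (p @ c # q) bs \<longleftrightarrow>
      (\<exists>us b vs. bs = us @ b # vs \<and> list_all2 ?Q p us \<and> list_all2 ?Q q vs \<and> ?Q c b)" for c bs
  proof
    assume "list_all2 ?Q (p @ c # q) bs"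
    then show "\<exists>us b vs. bs = us @ b # vs \<and> list_all2 ?Q p us \<and> list_all2 ?Q q vs \<and> ?Q c b"
      unfolding list_all2_append1 list_all2_Cons1 by blast
  qed (auto intro!: list_all2_appendI)
  have "list_all2 ?Q (p @ None # q) bs \<longleftrightarrow>
      list_all2 ?Q (p @ Some True # q) bs \<or> list_all2 ?Q (p @ Some False # q) bs" for bs
    unfolding split by (simp add: ex_bool_eq) blast
  then show ?thesis by (auto simp: pattern_enums_def)
qed

lemma pattern_enums_disjoint:
  "pattern_enums R V (p @ Some True # q) \<inter> pattern_enums R V (p @ Some False # q) = {}"
proof -
  have "steps R vs ! length p = b" if "vs \<in> pattern_enums R V (p @ Some b # q)" for vs b
    using that by (auto simp: pattern_enums_def dest!: list_all2_nthD[where p = "length p"])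
  from this[of _ True] this[of _ False] show ?thesis by fastforce
qed

text \<open>Solved for the last term, this trades a backward constraint for an unconstrained step
  minus a forward one: the inclusion-exclusion step.\<close>

lemma card_pattern_enums_None:
  assumes "finite V"
  shows "card (pattern_enums R V (p @ None # q)) =
     card (pattern_enums R V (p @ Some True # q)) + card (pattern_enums R V (p @ Some False # q))"
  unfolding pattern_enums_None
  by (intro card_Un_disjoint finite_pattern_enums pattern_enums_disjoint assms)

text \<open>An unconstrained step severs the enumeration: any subset \<open>A\<close> may come
  first, and the two pieces are then chosen independently.\<close>

lemma card_pattern_enums_split:
  assumes "finite V"
  shows "card (pattern_enums R V (p @ None # q)) =
     (\<Sum>A\<in>Pow V. card (pattern_enums R A p) * card (pattern_enums R (V - A) q))"
proof -
  let ?S = "SIGMA A:Pow V. pattern_enums R A p \<times> pattern_enums R (V - A) q"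
  have "bij_betw (\<lambda>(A, xs, ys). xs @ ys) ?S (pattern_enums R V (p @ None # q))"
  proof (rule bij_betw_imageI)
    show "inj_on (\<lambda>(A, xs, ys). xs @ ys) ?S"
    proof (rule inj_onI, clarsimp)
      fix A xs ys B xs' ys'
      assume *: "xs @ ys = xs' @ ys'" "xs \<in> pattern_enums R A p" "xs' \<in> pattern_enums R B p"
      \<comment> \<open>The pattern \<open>p\<close> fixes the length of the first piece, so the cut
        can be recovered from the concatenation. Nonemptiness makes the truncated subtraction
        harmless.\<close>
      have "length p = length xs - 1" "length p = length xs' - 1" "xs \<noteq> []" "xs' \<noteq> []"
        using * by (auto simp: pattern_enums_def dest: list_all2_lengthD)
      then have "length xs = length xs'" by (cases xs; cases xs'; simp)
      with * show "A = B \<and> xs = xs' \<and> ys = ys'"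
        by (auto simp: pattern_enums_def)
    qed
    show "(\<lambda>(A, xs, ys). xs @ ys) ` ?S = pattern_enums R V (p @ None # q)"
    proof (intro equalityI subsetI)
      fix vs assume "vs \<in> (\<lambda>(A, xs, ys). xs @ ys) ` ?S"
      then show "vs \<in> pattern_enums R V (p @ None # q)"
        by (auto simp: pattern_enums_def steps_append intro!: list_all2_appendI)
    next
      fix vs assume vs: "vs \<in> pattern_enums R V (p @ None # q)"
      \<comment> \<open>A pattern of length k constrains k + 1 vertices, hence the cut after
        \<open>Suc (length p)\<close> entries.\<close>
      define xs where "xs = take (Suc (length p)) vs"
      define ys where "ys = drop (Suc (length p)) vs"
      have eq: "vs = xs @ ys" by (simp add: xs_def ys_def)
      have "length vs - 1 = Suc (length p + length q)"
        using vs by (auto simp: pattern_enums_def dest!: list_all2_lengthD)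
      then have len: "length xs = Suc (length p)" and ne: "xs \<noteq> []" "ys \<noteq> []"
        by (auto simp: xs_def ys_def)
      have "list_all2 (\<lambda>c b. c = None \<or> c = Some b) (p @ None # q)
              (steps R xs @ ((last xs, hd ys) \<in> R) # steps R ys)"
        using vs by (simp add: pattern_enums_def eq steps_append ne)
      then have "list_all2 (\<lambda>c b. c = None \<or> c = Some b) p (steps R xs)"
        "list_all2 (\<lambda>c b. c = None \<or> c = Some b) q (steps R ys)"
        using len by (simp_all add: list_all2_append)
      moreover have "distinct xs" "distinct ys" "set xs \<inter> set ys = {}" "V = set xs \<union> set ys"
        using vs by (auto simp: pattern_enums_def eq)
      ultimately have "(set xs, xs, ys) \<in> ?S"
        using ne by (auto simp: pattern_enums_def)
      then show "vs \<in> (\<lambda>(A, xs, ys). xs @ ys) ` ?S"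
        unfolding eq by (rule rev_image_eqI) simp
    qed
  qed
  then have "card (pattern_enums R V (p @ None # q)) = card ?S"
    by (simp add: bij_betw_same_card)
  also have "\<dots> = (\<Sum>A\<in>Pow V. card (pattern_enums R A p \<times> pattern_enums R (V - A) q))"
    using assms by (intro card_SigmaI) (auto intro!: finite_pattern_enums dest: finite_subset)
  finally show ?thesis by (simp add: card_cartesian_product)
qed

text \<open>Without \<open>None\<close> the pattern is constant, hence a palindrome. Otherwise a
  \<open>None\<close> cuts it into two shorter patterns on complementary vertex sets, and reversal
  only swaps the two factors. The set \<open>V\<close> varies in the induction because the pieces
  live on subsets.\<close>

lemma card_pattern_enums_rev_positive:
  assumes "finite V" "Some False \<notin> set p"
  shows "card (pattern_enums R V (rev p)) = card (pattern_enums R V p)"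
  using assms
proof (induction "length p" arbitrary: p V rule: less_induct)
  case less
  show ?case
  proof (cases "None \<in> set p")
    case False
    have "c = Some True" if "c \<in> set p" for c
    proof -
      have "c \<noteq> None" "c \<noteq> Some False" using that less.prems(2) False by metis+
      then show ?thesis by (cases c) auto
    qed
    then have "p = replicate (length p) (Some True)" by (intro replicate_eqI) auto
    then obtain n where "p = replicate n (Some True)" ..
    then show ?thesis by simp
  next
    case True
    then obtain p1 p2 where p: "p = p1 @ None # p2" by (meson split_list)
    have IH: "card (pattern_enums R A (rev p1)) = card (pattern_enums R A p1)"
      "card (pattern_enums R A (rev p2)) = card (pattern_enums R A p2)" if "A \<subseteq> V" for A
      using less.hyps[of p1 A] less.hyps[of p2 A] less.prems that finite_subset
      by (auto simp: p)
    have "card (pattern_enums R V (rev p)) =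
        (\<Sum>A\<in>Pow V. card (pattern_enums R A (rev p2)) * card (pattern_enums R (V - A) (rev p1)))"
      by (simp add: p card_pattern_enums_split less.prems)
    also have "\<dots> = (\<Sum>A\<in>Pow V. card (pattern_enums R A p2) * card (pattern_enums R (V - A) p1))"
      by (intro sum.cong) (auto simp: IH)
    \<comment> \<open>Complementation in \<open>V\<close> permutes the subsets and exchanges the
      roles of the two pieces.\<close>
    also have "\<dots> = (\<Sum>A\<in>Pow V. card (pattern_enums R A p1) * card (pattern_enums R (V - A) p2))"
      by (rule sum.reindex_bij_witness[of _ "\<lambda>A. V - A" "\<lambda>A. V - A"])
        (auto simp: double_diff)
    also have "\<dots> = card (pattern_enums R V p)"
      by (simp add: p card_pattern_enums_split less.prems)
    finally show ?thesis .
  qed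
qed

text \<open>Changing one \<open>Some False\<close> to \<open>None\<close> or
  \<open>Some True\<close> lowers the number of backward constraints. The claim for these two
  patterns gives it for \<open>p\<close> by subtraction, so no explicit bijection is
  produced.\<close>

lemma card_pattern_enums_rev:
  assumes "finite V"
  shows "card (pattern_enums R V (rev p)) = card (pattern_enums R V p)"
proof (induction "count_list p (Some False)" arbitrary: p rule: less_induct)
  case less
  show ?case
  proof (cases "Some False \<in> set p")
    case False
    then show ?thesis by (rule card_pattern_enums_rev_positive[OF assms])
  next
    case True
    then obtain p1 p2 where p: "p = p1 @ Some False # p2" by (meson split_list)
    have "card (pattern_enums R V (rev (p1 @ c # p2))) = card (pattern_enums R V (p1 @ c # p2))"
      if "c \<noteq> Some False" for c
      by (rule less.hyps) (use that in \<open>simp add: p\<close>)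
    from this[of None] this[of "Some True"] show ?thesis
      using card_pattern_enums_None[OF assms, of R p1 p2]
        card_pattern_enums_None[OF assms, of R "rev p2" "rev p1"]
      by (simp add: p)
  qed
qed

section \<open>Reversal and complementation of full step words\<close>

lemma word_enums_eq: "word_enums R V w = pattern_enums R V (map Some w)"
proof -
  have "list_all2 (\<lambda>c b. c = None \<or> c = Some b) (map Some w) bs \<longleftrightarrow> bs = w" for bs
    by (auto simp: list_all2_map1 list.rel_eq)
  then show ?thesis by (simp add: word_enums_def pattern_enums_def)
qed

lemma finite_word_enums: "finite V \<Longrightarrow> finite (word_enums R V w)"
  by (simp add: word_enums_eq finite_pattern_enums)

lemma card_word_enums_rev:
  "finite V \<Longrightarrow> card (word_enums R V (rev w)) = card (word_enums R V w)"
  by (metis card_pattern_enums_rev rev_map word_enums_eq)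

lemma rev_mem_word_enums:
  assumes "\<And>u v. u \<in> V \<Longrightarrow> v \<in> V \<Longrightarrow> u \<noteq> v \<Longrightarrow> ((u, v) \<in> R) \<noteq> ((v, u) \<in> R)"
    and "vs \<in> word_enums R V w"
  shows "rev vs \<in> word_enums R V (map Not (rev w))"
proof -
  have vs: "distinct vs" "set vs = V" using assms(2) by (simp_all add: word_enums_def)
  have "steps R (rev vs) = map Not (rev (steps R vs))"
    using vs(1) by (rule steps_rev) (use vs(2) assms(1) in blast)
  with assms(2) show ?thesis by (simp add: word_enums_def)
qed

lemma map_Not_Not [simp]: "map Not (map Not w) = w"
  by (simp add: comp_def)

text \<open>Reversing lists is a bijection from the enumerations with word \<open>rev w\<close> to
  those with word \<open>map Not w\<close>; \<open>card_word_enums_rev\<close> then replaces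
  \<open>rev w\<close> by \<open>w\<close>.\<close>

lemma card_word_enums_Not:
  assumes "finite V"
    and tour: "\<And>u v. u \<in> V \<Longrightarrow> v \<in> V \<Longrightarrow> u \<noteq> v \<Longrightarrow> ((u, v) \<in> R) \<noteq> ((v, u) \<in> R)"
  shows "card (word_enums R V (map Not w)) = card (word_enums R V w)"
proof -
  have rev: "rev vs \<in> word_enums R V (map Not (rev u))" if "vs \<in> word_enums R V u" for vs u
    by (rule rev_mem_word_enums[OF _ that]) (rule tour)
  have "bij_betw rev (word_enums R V (rev w)) (word_enums R V (map Not w))"
  proof (rule bij_betw_byWitness[where f' = rev])
    show "rev ` word_enums R V (rev w) \<subseteq> word_enums R V (map Not w)"
      using rev[of _ "rev w"] by auto
    show "rev ` word_enums R V (map Not w) \<subseteq> word_enums R V (rev w)"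
      using rev[of _ "map Not w"] by (auto simp: rev_map comp_def)
  qed simp_all
  then show ?thesis
    using card_word_enums_rev[OF assms(1), of R w] by (simp add: bij_betw_same_card)
qed

section \<open>Paths and their enumerations\<close>

text \<open>Unordered pairs make this set invariant under reversal; in a tournament it still
  determines the arcs of the path.\<close>

definition list_edges :: "'a list \<Rightarrow> 'a set set" where
  "list_edges xs = {{xs ! k, xs ! Suc k} | k. Suc k < length xs}"

lemma list_edges_short [simp]: "list_edges [] = {}" "list_edges [x] = {}"
  by (auto simp: list_edges_def)

lemma list_edges_Cons [simp]: "list_edges (x # y # zs) = insert {x, y} (list_edges (y # zs))"
proof -
  have "(\<exists>k. P k \<and> Suc k < Suc n) \<longleftrightarrow> (P 0 \<and> 0 < n) \<or> (\<exists>k. P (Suc k) \<and> Suc k < n)" for P n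
    by (metis Suc_less_eq not0_implies_Suc)
  from this[where n = "Suc (length zs)"] show ?thesis
    by (auto simp: list_edges_def)
qed

lemma list_edges_subset: "e \<in> list_edges xs \<Longrightarrow> e \<subseteq> set xs"
  by (auto simp: list_edges_def)

lemma list_edges_rev [simp]: "list_edges (rev xs) = list_edges xs"
proof -
  have "list_edges (rev ys) \<subseteq> list_edges ys" for ys :: "'a list"
  proof
    fix e assume "e \<in> list_edges (rev ys)"
    then obtain k where k: "Suc k < length ys" "e = {rev ys ! k, rev ys ! Suc k}"
      by (auto simp: list_edges_def)
    then have "e = {ys ! (length ys - Suc (Suc k)), ys ! Suc (length ys - Suc (Suc k))}"
      by (auto simp: rev_nth Suc_diff_Suc)
    moreover have "Suc (length ys - Suc (Suc k)) < length ys" using k by simp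
    ultimately show "e \<in> list_edges ys" unfolding list_edges_def by blast
  qed
  from this[of xs] this[of "rev xs"] show ?thesis by auto
qed

text \<open>The common head lies on at most one edge, which reveals the second vertex. Removing that
  edge leaves the same situation for the tails.\<close>

lemma list_edges_eq_same_hd:
  assumes "distinct (a # xs)" "distinct (a # ys)" "list_edges (a # xs) = list_edges (a # ys)"
  shows "xs = ys"
  using assms
proof (induction xs arbitrary: a ys)
  case Nil
  then show ?case by (cases ys) auto
next
  case (Cons b xs)
  then obtain c ys' where ys: "ys = c # ys'" by (cases ys) auto
  have out: "{a, z} \<notin> list_edges (b # xs)" "{a, z} \<notin> list_edges (c # ys')" for z
    using Cons.prems(1,2) list_edges_subset unfolding ys by (metis distinct.simps(2) insert_subset)+
  have eq: "insert {a, b} (list_edges (b # xs)) = insert {a, c} (list_edges (c # ys'))"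
    using Cons.prems(3) by (simp add: ys)
  then have "{a, b} = {a, c}" using out by blast
  then have "b = c" by (auto simp: doubleton_eq_iff)
  with eq out have "list_edges (b # xs) = list_edges (b # ys')"
    by (metis insert_ident)
  with Cons.IH[of b ys'] Cons.prems show ?case by (simp add: ys \<open>b = c\<close>)
qed

text \<open>As the head of \<open>a # xs\<close>, the vertex \<open>a\<close> lies on at most one
  edge, whereas an interior vertex of \<open>ys\<close> would have two distinct neighbours.\<close>

lemma list_edges_hd_end:
  assumes "distinct (a # xs)" "distinct ys" "set ys = set (a # xs)"
    and "list_edges ys = list_edges (a # xs)"
  shows "hd ys = a \<or> last ys = a"
proof (rule ccontr)
  assume *: "\<not> ?thesis"
  obtain ps qs where ys: "ys = ps @ a # qs"
    using assms(3) by (metis list.set_intros(1) split_list)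
  from * ys have "ps \<noteq> []" "qs \<noteq> []" by auto
  then obtain ps' u v qs' where "ps = ps' @ [u]" "qs = v # qs'"
    by (metis append_butlast_last_id list.exhaust)
  then have ys: "ys = ps' @ u # a # v # qs'" by (simp add: ys)
  have "Suc (length ps') < length ys" "{u, a} = {ys ! length ps', ys ! Suc (length ps')}"
    "Suc (Suc (length ps')) < length ys"
    "{a, v} = {ys ! Suc (length ps'), ys ! Suc (Suc (length ps'))}"
    by (auto simp: ys nth_append)
  then have "{u, a} \<in> list_edges ys" "{a, v} \<in> list_edges ys"
    unfolding list_edges_def by blast+
  then have mem: "{u, a} \<in> list_edges (a # xs)" "{a, v} \<in> list_edges (a # xs)"
    by (simp_all add: assms(4))
  then obtain b xs' where xs: "xs = b # xs'" by (cases xs) auto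
  have "{a, z} \<notin> list_edges (b # xs')" for z
    using assms(1) list_edges_subset unfolding xs by (metis distinct.simps(2) insert_subset)
  with mem have "{a, u} = {a, b}" "{a, v} = {a, b}"
    by (auto simp: xs insert_commute)
  then have "u = v" by (auto simp: doubleton_eq_iff)
  with assms(2) show False by (simp add: ys)
qed

lemma list_edges_eq_imp:
  assumes "distinct xs" "distinct ys" "set ys = set xs" "list_edges ys = list_edges xs"
  shows "ys = xs \<or> ys = rev xs"
proof (cases xs)
  case Nil
  then show ?thesis using assms by simp
next
  case (Cons a xs')
  have same: "zs = xs" if "hd zs = a" "distinct zs" "zs \<noteq> []" "list_edges zs = list_edges xs" for zs
    using that list_edges_eq_same_hd[of a xs' "tl zs"] assms(1) Cons by (cases zs) auto
  have "ys \<noteq> []" using assms(3) Cons by auto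
  have "hd ys = a \<or> last ys = a"
    using list_edges_hd_end[of a xs' ys] assms Cons by simp
  then show ?thesis
  proof
    assume "hd ys = a"
    then show ?thesis using same assms \<open>ys \<noteq> []\<close> by simp
  next
    assume "last ys = a"
    then have "rev ys = xs" using same[of "rev ys"] assms \<open>ys \<noteq> []\<close> by (simp add: hd_rev)
    then show ?thesis by auto
  qed
qed

section \<open>Paths as subdigraphs and the number of their enumerations\<close>

lemma parcs_path_of: "parcs (path_of T vs) = {(u, v) \<in> parcs T. {u, v} \<in> list_edges vs}"
  by (auto simp: path_of_def list_edges_def)

lemma path_of_rev: "path_of T (rev vs) = path_of T vs"
  by (rule pair_pre_digraph.equality)
    (simp_all add: parcs_path_of, simp add: path_of_def)

lemma (in tournament) path_of_eq_iff:
  assumes "distinct vs" "distinct vs'" "set vs \<subseteq> pverts T" "set vs' \<subseteq> pverts T"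
  shows "path_of T vs' = path_of T vs \<longleftrightarrow> vs' = vs \<or> vs' = rev vs"
proof
  \<comment> \<open>In a tournament every edge of the list carries an arc, so the arcs of the path
    give back \<open>list_edges\<close>.\<close>
  have sub: "list_edges xs \<subseteq> list_edges ys"
    if "distinct xs" "set xs \<subseteq> pverts T" "path_of T xs = path_of T ys" for xs ys
  proof
    fix e assume e: "e \<in> list_edges xs"
    then obtain k where k: "Suc k < length xs" "e = {xs ! k, xs ! Suc k}"
      by (auto simp: list_edges_def)
    then have "xs ! k \<noteq> xs ! Suc k" using that(1) by (simp add: nth_eq_iff_index_eq)
    moreover have "xs ! k \<in> pverts T" "xs ! Suc k \<in> pverts T" using k that(2) by auto
    ultimately obtain u v where uv: "(u, v) \<in> parcs T" "e = {u, v}"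
      using exactly_one_arc[of "xs ! k" "xs ! Suc k"] k(2) by (metis insert_commute)
    with e have "(u, v) \<in> parcs (path_of T xs)" by (simp add: parcs_path_of)
    then show "e \<in> list_edges ys" using that(3) uv by (simp add: parcs_path_of)
  qed
  assume *: "path_of T vs' = path_of T vs"
  then have "set vs' = set vs" by (simp add: path_of_def)
  moreover have "list_edges vs' = list_edges vs"
    using sub[of vs vs'] sub[of vs' vs] assms * by auto
  ultimately show "vs' = vs \<or> vs' = rev vs"
    using assms by (intro list_edges_eq_imp)
qed (auto simp: path_of_rev)

text \<open>Intended for \<open>path_of T\<close> as \<open>f\<close>: fibres of constant size turn
  a count of enumerations into a count of paths.\<close>

lemma card_eq_fibre_mult:
  assumes "finite A" "\<And>x. x \<in> A \<Longrightarrow> card {y \<in> A. f y = f x} = k"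
  shows "card A = k * card (f ` A)"
proof -
  have "card A = (\<Sum>z\<in>f ` A. card {y \<in> A. f y = z})"
    using sum.image_gen[OF assms(1), of "\<lambda>_. 1 :: nat" f] by simp
  also have "\<dots> = (\<Sum>z\<in>f ` A. k)" by (rule sum.cong) (auto simp: assms(2))
  finally show ?thesis by simp
qed

text \<open>The enumerations of the path of \<open>vs\<close> are \<open>vs\<close> and
  \<open>rev vs\<close>. The latter has word \<open>map Not (rev w)\<close>, so whether it is
  counted too depends on \<open>w\<close> alone. As \<open>w\<close> is nonempty, the two
  differ.\<close>

lemma (in tournament) card_word_enums_paths:
  assumes "w \<noteq> []"
  shows "card (word_enums (parcs T) (pverts T) w) =
    (if map Not (rev w) = w then 2 else 1) * card (path_of T ` word_enums (parcs T) (pverts T) w)"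
    (is "card ?A = ?k * _")
proof (rule card_eq_fibre_mult)
  show "finite ?A" by (simp add: finite_word_enums)
  fix vs assume vs: "vs \<in> ?A"
  then have "length vs - 1 = length w" by (auto simp: word_enums_def)
  moreover have "length w \<noteq> 0" using assms by simp
  ultimately have len: "2 \<le> length vs" by linarith
  have "distinct vs" using vs by (simp add: word_enums_def)
  have "vs \<noteq> rev vs"
  proof
    assume "vs = rev vs"
    then have "hd vs = last vs" by (metis hd_rev)
    then have "vs ! 0 = vs ! (length vs - 1)" using len
      by (metis hd_conv_nth last_conv_nth list.size(3) not_numeral_le_zero)
    moreover have "0 < length vs" "length vs - 1 < length vs" using len by linarith+
    ultimately have "0 = length vs - 1" using \<open>distinct vs\<close> nth_eq_iff_index_eq by blast
    then show False using len by linarith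
  qed
  have "rev vs \<in> word_enums (parcs T) (pverts T) (map Not (rev w))"
    by (rule rev_mem_word_enums[OF _ vs]) (rule exactly_one_arc)
  then have "rev vs \<in> ?A \<longleftrightarrow> map Not (rev w) = w" by (auto simp: word_enums_def)
  moreover have "{ys \<in> ?A. path_of T ys = path_of T vs} = {ys \<in> ?A. ys = vs \<or> ys = rev vs}"
    using vs by (auto simp: word_enums_def path_of_eq_iff)
  ultimately have "{ys \<in> ?A. path_of T ys = path_of T vs} =
      (if map Not (rev w) = w then {vs, rev vs} else {vs})"
    using vs by auto
  then show "card {ys \<in> ?A. path_of T ys = path_of T vs} = ?k"
    using \<open>vs \<noteq> rev vs\<close> by simp
qed

section \<open>Block types and step words\<close>

text \<open>For nonempty alternating \<open>\<alpha>\<close>, an enumeration has type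
  \<open>\<alpha>\<close> exactly when this is its step word; see
  \<open>has_type_iff_steps\<close>.\<close>

definition sign_word :: "int list \<Rightarrow> bool list" where
  "sign_word \<alpha> = concat (map (\<lambda>a. replicate (nat \<bar>a\<bar>) (0 < a)) \<alpha>)"

text \<open>Block \<open>m\<close> consists of the steps from \<open>block_start \<alpha> m\<close>
  up to but excluding \<open>block_start \<alpha> (Suc m)\<close>. Read as vertex positions, these
  two numbers are its end vertices.\<close>

definition block_start :: "int list \<Rightarrow> nat \<Rightarrow> nat" where
  "block_start \<alpha> m = (\<Sum>a\<leftarrow>take m \<alpha>. nat \<bar>a\<bar>)"

text \<open>The explicit condition on 0 excludes \<open>[0]\<close>, where the product condition is
  vacuous.\<close>

abbreviation alternating :: "int list \<Rightarrow> bool" where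
  "alternating \<alpha> \<equiv> 0 \<notin> set \<alpha> \<and> successively (\<lambda>a b. a * b < 0) \<alpha>"

lemma length_sign_word: "length (sign_word \<alpha>) = (\<Sum>a\<leftarrow>\<alpha>. nat \<bar>a\<bar>)"
  by (induction \<alpha>) (auto simp: sign_word_def)

lemma int_length_sign_word: "int (length (sign_word \<alpha>)) = (\<Sum>a\<leftarrow>\<alpha>. \<bar>a\<bar>)"
  by (induction \<alpha>) (auto simp: sign_word_def)

lemma block_start_0 [simp]: "block_start \<alpha> 0 = 0"
  by (simp add: block_start_def)

lemma block_start_Suc:
  "m < length \<alpha> \<Longrightarrow> block_start \<alpha> (Suc m) = block_start \<alpha> m + nat \<bar>\<alpha> ! m\<bar>"
  by (simp add: block_start_def take_Suc_conv_app_nth)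

lemma block_start_length: "block_start \<alpha> (length \<alpha>) = length (sign_word \<alpha>)"
  by (simp add: block_start_def length_sign_word)

lemma block_start_mono: "m \<le> m' \<Longrightarrow> block_start \<alpha> m \<le> block_start \<alpha> m'"
  by (auto simp: block_start_def take_add dest!: le_Suc_ex)

lemma block_start_less:
  assumes "0 \<notin> set \<alpha>" "m < m'" "m < length \<alpha>"
  shows "block_start \<alpha> m < block_start \<alpha> m'"
proof -
  have "\<alpha> ! m \<noteq> 0" using assms by (metis nth_mem)
  then have "block_start \<alpha> m < block_start \<alpha> (Suc m)" using assms by (simp add: block_start_Suc)
  also have "\<dots> \<le> block_start \<alpha> m'" using assms by (intro block_start_mono) simp
  finally show ?thesis .
qed

lemma nth_sign_word:
  assumes "m < length \<alpha>" "block_start \<alpha> m \<le> k" "k < block_start \<alpha> (Suc m)"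
  shows "sign_word \<alpha> ! k \<longleftrightarrow> 0 < \<alpha> ! m"
  using assms
proof (induction \<alpha> arbitrary: m k)
  case (Cons a \<alpha>)
  show ?case
  proof (cases m)
    case 0
    then show ?thesis using Cons.prems
      by (auto simp: sign_word_def nth_append block_start_def)
  next
    case (Suc m')
    then show ?thesis using Cons.prems Cons.IH[of m' "k - nat \<bar>a\<bar>"]
      by (auto simp: sign_word_def nth_append block_start_def)
  qed
qed simp

lemma ex_block_of_position:
  assumes "k < length (sign_word \<alpha>)"
  shows "\<exists>m < length \<alpha>. block_start \<alpha> m \<le> k \<and> k < block_start \<alpha> (Suc m)"
proof -
  have ex: "k < block_start \<alpha> (length \<alpha>)" using assms by (simp add: block_start_length)
  \<comment> \<open>The first block start beyond \<open>k\<close> has positive index, since block 0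
    starts at 0; its predecessor is the block containing \<open>k\<close>.\<close>
  define m where "m = (LEAST m. k < block_start \<alpha> m)"
  have m: "k < block_start \<alpha> m" "m \<le> length \<alpha>"
    using LeastI[of "\<lambda>m. k < block_start \<alpha> m", OF ex] Least_le[of "\<lambda>m. k < block_start \<alpha> m", OF ex]
    by (simp_all add: m_def)
  then obtain m' where m': "m = Suc m'" by (cases m) auto
  have "\<not> k < block_start \<alpha> m'"
    using not_less_Least[of m' "\<lambda>m. k < block_start \<alpha> m"] m' by (simp flip: m_def)
  with m m' show ?thesis by (intro exI[of _ m']) simp
qed

text \<open>Signed run-length encoding, built from the right: a new letter either lengthens the
  first run or opens a new one.\<close>

lemma ex_alternating_sign_word:
  "w \<noteq> [] \<Longrightarrow> \<exists>\<beta>. \<beta> \<noteq> [] \<and> alternating \<beta> \<and> sign_word \<beta> = w"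
proof (induction w rule: list_nonempty_induct)
  case (single b)
  show ?case
    by (rule exI[of _ "[if b then 1 else - 1]"]) (simp add: sign_word_def)
next
  case (cons b w)
  then obtain c \<beta> where \<beta>: "alternating (c # \<beta>)" "sign_word (c # \<beta>) = w"
    by (metis list.exhaust)
  \<comment> \<open>The letter \<open>b\<close> as a signed unit; added to an entry of the same sign
    it lengthens that run by one.\<close>
  define s :: int where "s = (if b then 1 else - 1)"
  show ?case
  proof (cases "b = (0 < c)")
    case True
    have "nat \<bar>c + s\<bar> = Suc (nat \<bar>c\<bar>)" "(0 < c + s) = (0 < c)" "c + s \<noteq> 0"
      using True \<beta>(1) by (auto simp: s_def)
    moreover have "alternating ((c + s) # \<beta>)"
      using \<beta>(1) True by (cases \<beta>) (auto simp: s_def mult_less_0_iff)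
    ultimately show ?thesis using \<beta>(2) True
      by (intro exI[of _ "(c + s) # \<beta>"]) (simp add: sign_word_def)
  next
    case False
    then have "alternating (s # c # \<beta>)" "sign_word (s # c # \<beta>) = b # w"
      using \<beta> by (auto simp: s_def sign_word_def mult_less_0_iff)
    then show ?thesis by blast
  qed
qed

section \<open>Maximal runs of a word and the type read off from them\<close>

definition run :: "bool list \<Rightarrow> bool \<Rightarrow> nat \<Rightarrow> nat \<Rightarrow> bool" where
  "run w b i j \<longleftrightarrow> i < j \<and> j \<le> length w \<and> (\<forall>k\<in>{i..<j}. w ! k = b)"

text \<open>The counterpart of \<open>blocks\<close> on step words. Pairs still denote vertex
  positions, so the bound \<open>j \<le> length w\<close> in \<open>run\<close> matches
  \<open>j < length vs\<close>, a word being one shorter than its list.\<close>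

definition max_runs :: "bool list \<Rightarrow> (nat \<times> nat) set" where
  "max_runs w = {(i, j). (\<exists>b. run w b i j) \<and>
    (\<forall>i' j'. i' \<le> i \<longrightarrow> j \<le> j' \<longrightarrow> (\<exists>b. run w b i' j') \<longrightarrow> i' = i \<and> j' = j)}"

lemma run_sign_word:
  assumes "0 \<notin> set \<alpha>" "m < length \<alpha>"
  shows "run (sign_word \<alpha>) (0 < \<alpha> ! m) (block_start \<alpha> m) (block_start \<alpha> (Suc m))"
  using assms block_start_less[of \<alpha> m "Suc m"] block_start_mono[of "Suc m" "length \<alpha>" \<alpha>]
  by (auto simp: run_def nth_sign_word block_start_length)

text \<open>Consecutive signs differ, so no run contains the last step of one block and the first of the next.\<close>
lemma run_not_across:
  assumes "alternating \<alpha>" "Suc m < length \<alpha>" "run (sign_word \<alpha>) b i j"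
    and "i < block_start \<alpha> (Suc m)" "block_start \<alpha> (Suc m) < j"
  shows False
proof -
  let ?e = "block_start \<alpha> (Suc m)"
  have "block_start \<alpha> m < ?e" "?e < block_start \<alpha> (Suc (Suc m))"
    using assms by (simp_all add: block_start_less)
  then have "sign_word \<alpha> ! (?e - 1) = (0 < \<alpha> ! m)" "sign_word \<alpha> ! ?e = (0 < \<alpha> ! Suc m)"
    using assms(2) nth_sign_word[of m \<alpha> "?e - 1"] nth_sign_word[of "Suc m" \<alpha> ?e] by auto
  moreover have "\<alpha> ! m * \<alpha> ! Suc m < 0"
    using assms(1,2) by (auto simp: successively_conv_nth)
  moreover have "?e - 1 \<in> {i..<j}" "?e \<in> {i..<j}" using assms(4,5) by auto
  then have "sign_word \<alpha> ! (?e - 1) = b" "sign_word \<alpha> ! ?e = b"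
    using assms(3) unfolding run_def by blast+
  ultimately show False by (auto simp: mult_less_0_iff)
qed

text \<open>A run starting in a block cannot pass the end of that block, so it lies inside it and,
  if maximal, fills it. Conversely, extending a block on either side would cross a sign change or
  leave the word.\<close>

lemma max_runs_sign_word:
  assumes "alternating \<alpha>"
  shows "max_runs (sign_word \<alpha>) =
    (\<lambda>m. (block_start \<alpha> m, block_start \<alpha> (Suc m))) ` {..<length \<alpha>}"
proof (intro equalityI subsetI)
  fix x assume x: "x \<in> max_runs (sign_word \<alpha>)"
  obtain i j where ij: "x = (i, j)" by (cases x)
  with x obtain b where run: "run (sign_word \<alpha>) b i j" by (auto simp: max_runs_def)
  have max: "i' = i \<and> j' = j" if "i' \<le> i" "j \<le> j'" "run (sign_word \<alpha>) b i' j'" for i' j' b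
    using x that unfolding ij max_runs_def by blast
  have "i < length (sign_word \<alpha>)" using run by (auto simp: run_def)
  then obtain m where m: "m < length \<alpha>" "block_start \<alpha> m \<le> i" "i < block_start \<alpha> (Suc m)"
    using ex_block_of_position by blast
  have "j \<le> block_start \<alpha> (Suc m)"
  proof (cases "Suc m < length \<alpha>")
    case True
    with run_not_across[OF assms True run m(3)] show ?thesis by (meson not_le)
  next
    case False
    with m(1) have "Suc m = length \<alpha>" by simp
    with run show ?thesis by (simp add: run_def block_start_length)
  qed
  then show "x \<in> (\<lambda>m. (block_start \<alpha> m, block_start \<alpha> (Suc m))) ` {..<length \<alpha>}"
    using max[OF m(2)] run_sign_word[of \<alpha> m] assms m ij by blast
next
  fix x assume "x \<in> (\<lambda>m. (block_start \<alpha> m, block_start \<alpha> (Suc m))) ` {..<length \<alpha>}"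
  then obtain m where m: "m < length \<alpha>" "x = (block_start \<alpha> m, block_start \<alpha> (Suc m))" by auto
  have less: "block_start \<alpha> m < block_start \<alpha> (Suc m)"
    using assms m by (simp add: block_start_less)
  have "i' = block_start \<alpha> m \<and> j' = block_start \<alpha> (Suc m)"
    if "i' \<le> block_start \<alpha> m" "block_start \<alpha> (Suc m) \<le> j'" "run (sign_word \<alpha>) b i' j'" for i' j' b
  proof
    show "i' = block_start \<alpha> m"
    proof (cases m)
      case (Suc m')
      with run_not_across[OF assms _ that(3), of m'] m less that(1,2) show ?thesis by fastforce
    qed (use that(1) in simp)
    show "j' = block_start \<alpha> (Suc m)"
    proof (cases "Suc m < length \<alpha>")
      case True
      with run_not_across[OF assms True that(3)] less that(1,2) show ?thesis by fastforce
    next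
      case False
      with m(1) have "Suc m = length \<alpha>" by simp
      with that show ?thesis by (simp add: run_def block_start_length)
    qed
  qed
  then show "x \<in> max_runs (sign_word \<alpha>)"
    using run_sign_word[of \<alpha> m] assms m by (auto simp: max_runs_def)
qed

text \<open>The block condition of \<open>has_type\<close>, stated for the step word alone, so that
  existence and uniqueness of the type become questions about words.\<close>

definition word_type :: "bool list \<Rightarrow> int list \<Rightarrow> bool" where
  "word_type w \<alpha> \<longleftrightarrow> (\<exists>bs. set bs = max_runs w \<and> sorted_wrt (\<lambda>b b'. fst b < fst b') bs \<and>
     length bs = length \<alpha> \<and>
     (\<forall>m < length \<alpha>. case bs ! m of (i, j) \<Rightarrow>
        int (j - i) = \<bar>\<alpha> ! m\<bar> \<and> (run w True i j \<longleftrightarrow> \<alpha> ! m > 0)))"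

lemma word_type_sign_word:
  assumes "alternating \<alpha>"
  shows "word_type (sign_word \<alpha>) \<alpha>"
proof -
  define bs where "bs = map (\<lambda>m. (block_start \<alpha> m, block_start \<alpha> (Suc m))) [0..<length \<alpha>]"
  have "set bs = max_runs (sign_word \<alpha>)"
    by (simp add: bs_def max_runs_sign_word[OF assms] atLeast0LessThan)
  moreover have "sorted_wrt (\<lambda>b b'. fst b < fst b') bs"
    using assms by (auto simp: bs_def sorted_wrt_iff_nth_less block_start_less)
  \<comment> \<open>A run is nonempty, so its first letter decides between \<open>True\<close> and
    \<open>False\<close>.\<close>
  moreover have "run (sign_word \<alpha>) True (block_start \<alpha> m) (block_start \<alpha> (Suc m)) \<longleftrightarrow> 0 < \<alpha> ! m"
    if "m < length \<alpha>" for m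
    using run_sign_word[of \<alpha> m] assms that unfolding run_def
    by (metis atLeastLessThan_iff order_refl)
  ultimately show ?thesis
    unfolding word_type_def
    by (intro exI[of _ bs]) (auto simp: bs_def block_start_Suc)
qed

lemma sorted_wrt_fst_unique:
  fixes xs ys :: "('a :: linorder \<times> 'b) list"
  assumes "sorted_wrt (\<lambda>b b'. fst b < fst b') xs" "sorted_wrt (\<lambda>b b'. fst b < fst b') ys"
    and "set xs = set ys"
  shows "xs = ys"
proof -
  have s: "sorted_wrt (<) (map fst xs)" "sorted_wrt (<) (map fst ys)"
    using assms by (simp_all add: sorted_wrt_map)
  then have "inj_on fst (set xs)"
    by (metis distinct_map strict_sorted_iff)
  with s assms(3) show ?thesis
    by (intro map_sorted_distinct_set_unique[of fst]) (simp_all add: strict_sorted_iff)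
qed

text \<open>Sorting by start position leaves only one list of maximal runs. It fixes each absolute
  value and whether the entry is positive, which determines a nonzero integer.\<close>

lemma word_type_unique:
  assumes "word_type w \<alpha>" "word_type w \<beta>" "0 \<notin> set \<alpha>" "0 \<notin> set \<beta>"
  shows "\<alpha> = \<beta>"
proof -
  obtain bs where bs: "set bs = max_runs w" "sorted_wrt (\<lambda>b b'. fst b < fst b') bs"
    "length bs = length \<alpha>"
    "\<And>m. m < length \<alpha> \<Longrightarrow> int (snd (bs ! m) - fst (bs ! m)) = \<bar>\<alpha> ! m\<bar> \<and>
       (run w True (fst (bs ! m)) (snd (bs ! m)) \<longleftrightarrow> \<alpha> ! m > 0)"
    using assms(1) by (auto simp: word_type_def case_prod_beta)
  obtain cs where cs: "set cs = max_runs w" "sorted_wrt (\<lambda>b b'. fst b < fst b') cs"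
    "length cs = length \<beta>"
    "\<And>m. m < length \<beta> \<Longrightarrow> int (snd (cs ! m) - fst (cs ! m)) = \<bar>\<beta> ! m\<bar> \<and>
       (run w True (fst (cs ! m)) (snd (cs ! m)) \<longleftrightarrow> \<beta> ! m > 0)"
    using assms(2) by (auto simp: word_type_def case_prod_beta)
  have eq: "bs = cs" using bs cs by (intro sorted_wrt_fst_unique) auto
  show ?thesis
  proof (rule nth_equalityI)
    show len: "length \<alpha> = length \<beta>" using bs(3) cs(3) eq by simp
    fix m assume m: "m < length \<alpha>"
    have "\<alpha> ! m \<noteq> 0" "\<beta> ! m \<noteq> 0" using assms(3,4) m len by (metis nth_mem)+
    moreover have "\<bar>\<alpha> ! m\<bar> = \<bar>\<beta> ! m\<bar>" "0 < \<alpha> ! m \<longleftrightarrow> 0 < \<beta> ! m"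
      using bs(4)[of m] cs(4)[of m] m len eq by simp_all
    ultimately show "\<alpha> ! m = \<beta> ! m" by (auto simp: abs_eq_iff)
  qed
qed

text \<open>Left to right, \<open>w\<close> is first written as the sign word of some alternating
  list, which uniqueness of the type identifies with \<open>\<alpha>\<close>.\<close>

lemma word_type_iff:
  assumes "alternating \<alpha>" "w \<noteq> []"
  shows "word_type w \<alpha> \<longleftrightarrow> w = sign_word \<alpha>"
proof
  assume "word_type w \<alpha>"
  moreover obtain \<beta> where "alternating \<beta>" "sign_word \<beta> = w"
    using ex_alternating_sign_word[OF assms(2)] by blast
  ultimately show "w = sign_word \<alpha>"
    using word_type_unique[of w \<alpha> \<beta>] word_type_sign_word[of \<beta>] assms(1) by auto
qed (use word_type_sign_word assms in blast)

section \<open>From paths in a tournament to step words\<close>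

context tournament
begin

lemma forward_seg_iff_run:
  "forward_seg T vs i j \<longleftrightarrow> run (steps (parcs T) vs) True i j"
proof -
  have "(vs ! k, vs ! Suc k) \<in> parcs T \<longleftrightarrow> steps (parcs T) vs ! k" if "Suc k < length vs" for k
    using that by (simp add: nth_steps)
  then show ?thesis by (auto simp: forward_seg_def run_def)
qed

lemma backward_seg_iff_run:
  assumes "path_enum T vs"
  shows "backward_seg T vs i j \<longleftrightarrow> run (steps (parcs T) vs) False i j"
proof -
  have "(vs ! Suc k, vs ! k) \<in> parcs T \<longleftrightarrow> \<not> steps (parcs T) vs ! k" if "Suc k < length vs" for k
  proof -
    have "vs ! k \<noteq> vs ! Suc k" "vs ! k \<in> pverts T" "vs ! Suc k \<in> pverts T"
      using assms that by (auto simp: path_enum_def nth_eq_iff_index_eq)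
    then show ?thesis using exactly_one_arc[of "vs ! k" "vs ! Suc k"] that by (simp add: nth_steps)
  qed
  then show ?thesis by (auto simp: backward_seg_def run_def)
qed

lemma blocks_eq_max_runs:
  assumes "path_enum T vs"
  shows "blocks T vs = max_runs (steps (parcs T) vs)"
proof -
  have "directed_seg T vs i j \<longleftrightarrow> (\<exists>b. run (steps (parcs T) vs) b i j)" for i j
    unfolding directed_seg_def forward_seg_iff_run backward_seg_iff_run[OF assms]
    by (metis (full_types))
  then show ?thesis by (simp add: blocks_def max_runs_def)
qed

lemma has_type_iff_steps:
  assumes "path_enum T vs" "alternating \<alpha>" "\<alpha> \<noteq> []"
  shows "has_type T vs \<alpha> \<longleftrightarrow> steps (parcs T) vs = sign_word \<alpha>"
proof -
  have "sign_word \<alpha> \<noteq> []" using assms(2,3) by (cases \<alpha>) (auto simp: sign_word_def)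
  have len: "int (length vs) = (\<Sum>a\<leftarrow>\<alpha>. \<bar>a\<bar>) + 1 \<longleftrightarrow>
      length (steps (parcs T) vs) = length (sign_word \<alpha>)"
    using assms(1) by (cases vs) (auto simp: path_enum_def simp flip: int_length_sign_word)
  have "has_type T vs \<alpha> \<longleftrightarrow> length (steps (parcs T) vs) = length (sign_word \<alpha>) \<and>
      word_type (steps (parcs T) vs) \<alpha>"
    using assms(2) unfolding has_type_def word_type_def blocks_eq_max_runs[OF assms(1)]
      forward_seg_iff_run len by auto
  \<comment> \<open>Equality of lengths ensures a nonempty step word, as
    \<open>word_type_iff\<close> requires.\<close>
  also have "\<dots> \<longleftrightarrow> steps (parcs T) vs = sign_word \<alpha>"
    using word_type_iff[OF assms(2)] \<open>sign_word \<alpha> \<noteq> []\<close> by (metis length_0_conv)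
  finally show ?thesis .
qed

text \<open>The order of \<open>T\<close> forces paths of this type to be Hamiltonian, so the demand
  \<open>set vs = V\<close> in \<open>word_enums\<close> loses none of them.\<close>

lemma paths_of_type_eq:
  assumes "alternating \<alpha>" "\<alpha> \<noteq> []" "int (card (pverts T)) = (\<Sum>a\<leftarrow>\<alpha>. \<bar>a\<bar>) + 1"
  shows "paths_of_type T \<alpha> = path_of T ` word_enums (parcs T) (pverts T) (sign_word \<alpha>)"
proof -
  have "set vs = pverts T" if "path_enum T vs" "steps (parcs T) vs = sign_word \<alpha>" for vs
  proof (rule card_subset_eq)
    have "length vs - 1 = length (sign_word \<alpha>)" by (simp flip: that(2))
    moreover have "card (pverts T) = length (sign_word \<alpha>) + 1"
      using assms(3) by (simp flip: int_length_sign_word)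
    ultimately show "card (set vs) = card (pverts T)"
      using that(1) by (cases vs) (auto simp: path_enum_def distinct_card)
  qed (use that in \<open>auto simp: path_enum_def\<close>)
  then have "path_enum T vs \<and> has_type T vs \<alpha> \<longleftrightarrow>
      vs \<in> word_enums (parcs T) (pverts T) (sign_word \<alpha>)" for vs
    using has_type_iff_steps[OF _ assms(1,2)] by (auto simp: path_enum_def word_enums_def)
  then show ?thesis unfolding paths_of_type_def by blast
qed

end

section \<open>Negation of types and the final comparison\<close>

lemma sign_word_uminus: "0 \<notin> set \<alpha> \<Longrightarrow> sign_word (map uminus \<alpha>) = map Not (sign_word \<alpha>)"
  by (induction \<alpha>) (auto simp: sign_word_def)

lemma alternating_nonzero:
  fixes \<alpha> :: "int list"
  assumes "\<alpha> \<noteq> []" "\<And>i. Suc i < length \<alpha> \<Longrightarrow> \<alpha> ! i * \<alpha> ! Suc i < 0" "\<alpha> \<noteq> [0]"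
  shows "0 \<notin> set \<alpha>"
proof
  assume "0 \<in> set \<alpha>"
  then obtain m where m: "m < length \<alpha>" "\<alpha> ! m = 0" by (metis in_set_conv_nth)
  have "\<not> Suc m < length \<alpha>" using assms(2)[of m] m(2) by auto
  moreover have "m = 0"
  proof (rule ccontr)
    assume "m \<noteq> 0"
    then obtain m' where "m = Suc m'" by (cases m) auto
    with assms(2)[of m'] m show False by simp
  qed
  ultimately have "length \<alpha> = 1" using m(1) by linarith
  with m \<open>m = 0\<close> have "\<alpha> = [0]" by (cases \<alpha>) auto
  with assms(3) show False by simp
qed

theorem theorem4:
  fixes T :: "'a pair_pre_digraph" and \<alpha> :: "int list"
  assumes "\<alpha> \<noteq> []"
    and "\<And>i. Suc i < length \<alpha> \<Longrightarrow> \<alpha> ! i * \<alpha> ! Suc i < 0"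
    and "\<alpha> ! 0 \<ge> 0"
    and "tournament T"
    and "int (card (pverts T)) = (\<Sum>a\<leftarrow>\<alpha>. \<bar>a\<bar>) + 1"
  shows "num_paths T \<alpha> = num_paths T (map uminus \<alpha>)"
\<comment> \<open>The type \<open>[0]\<close> equals its own negative; every other admissible type
  has only nonzero entries.\<close>
proof (cases "\<alpha> = [0]")
  case False
  interpret tournament T by fact
  have nz: "0 \<notin> set \<alpha>"
    using assms(1,2) False by (intro alternating_nonzero)
  then have alt: "alternating \<alpha>" using assms(2) by (simp add: successively_conv_nth)
  then have alt': "alternating (map uminus \<alpha>)" by (auto simp: successively_map)
  define w where "w = sign_word \<alpha>"
  define c where "c u = card (path_of T ` word_enums (parcs T) (pverts T) u)" for u
  have "w \<noteq> []" using nz assms(1) by (cases \<alpha>) (auto simp: w_def sign_word_def)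
  \<comment> \<open>Both words therefore have the same factor 1 or 2 between enumerations and paths,
    and it cancels.\<close>
  have "map Not (rev (map Not w)) = map Not w \<longleftrightarrow> map Not (rev w) = w"
    by (metis map_Not_Not rev_map)
  moreover have "card (word_enums (parcs T) (pverts T) (map Not w)) =
      card (word_enums (parcs T) (pverts T) w)"
    by (rule card_word_enums_Not) (simp, rule exactly_one_arc)
  ultimately have "c w = c (map Not w)"
    using card_word_enums_paths[of w] card_word_enums_paths[of "map Not w"] \<open>w \<noteq> []\<close>
    by (simp add: c_def split: if_splits)
  moreover have "num_paths T \<alpha> = c w"
    using paths_of_type_eq[OF alt assms(1,5)] by (simp add: num_paths_def c_def w_def)
  moreover have "num_paths T (map uminus \<alpha>) = c (map Not w)"
    using paths_of_type_eq[OF alt'] assms(1,5) nz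
    by (simp add: num_paths_def c_def w_def sign_word_uminus comp_def)
  ultimately show ?thesis by simp
qed simp

end
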